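(* Let $n\ge 2$ and $1\le d<n$, and let $E\subset\mathcal{T}'$ be any subspace. Then $$R_d(E)=\Big\{F\in(\mathcal{T}')^{G^n_d}\;:\;\exists g\in E\text{ such that } \hat F(k,A)=\hat g(k)\prod_{v\in A}\delta_{0,v\cdot k}\text{ for all }k\in\mathbb{Z}^n,\ A\in G^n_d\Big\}.$$
   Context: $\mathbb{T}^n=\mathbb{R}^n/\mathbb{Z}^n$; $\mathcal{T}=C^\infty(\mathbb{T}^n)$ (complex-valued) and $\mathcal{T}'$ is its dual, the space of distributions on $\mathbb{T}^n$; $\langle\cdot,\cdot\rangle$ is the bilinear duality pairing extending $\int_{\mathbb{T}^n}f\eta\,dx$. $B^A$ denotes the set of all maps $A\to B$. $G^n_d$ is the set of unordered linearly independent $d$-tuples $A=\{v_1,\dots,v_d\}$ of vectors in $\mathbb{Z}^n\setminus\{0\}$; $v\in A$ means that $v$ is one of the vectors $v_i$. For $f\in\mathcal{T}$, the $d$-plane Radon transform is $R_df(x,A)=\int_{[0,1]^d}f(x+t_1v_1+\dots+t_dv_d)\,dt_1\cdots dt_d$. For $f\in\mathcal{T}'$, $R_df(\cdot,A)\in\mathcal{T}'$ is defined by $\langle R_df(\cdot,A),\eta\rangle=\langle f,R_d\eta(\cdot,A)\rangle$ for all $\eta\in\mathcal{T}$. Thus $R_d$ is a map $\mathcal{T}'\to(\mathcal{T}')^{G^n_d}$, and $R_d(E)$ is the image of $E$. With $e_k(x)=\exp(2\pi i k\cdot x)$, the Fourier coefficients of $g\in\mathcal{T}'$ are $\hat g(k)=\langle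 g,e_{-k}\rangle$, $k\in\mathbb{Z}^n$. For $F\in(\mathcal{T}')^{G^n_d}$, $\hat F(k,A)$ is the $k$-th Fourier coefficient of the distribution $F(A)$. $\delta_{0,j}$ is the Kronecker delta ($1$ if $j=0$, else $0$). *)

theory Defs
  imports "HOL-Analysis.Analysis" "HOL-Library.Function_Algebras"
begin

definition int_lattice :: "(real ^ 'n) set" where
  "int_lattice = {k. \<forall>i. k $ i \<in> \<int>}"

definition partial_deriv :: "'n \<Rightarrow> (real ^ 'n \<Rightarrow> complex) \<Rightarrow> real ^ 'n \<Rightarrow> complex" where
  "partial_deriv i f x = frechet_derivative f (at x) (axis i 1)"

text \<open>A list of coordinates serves as a multi-index: the list \<open>[i, j]\<close> stands for the
  operator \<open>\<partial>\<^sub>i \<partial>\<^sub>j\<close>.\<close>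

definition iter_partial :: "'n list \<Rightarrow> (real ^ 'n \<Rightarrow> complex) \<Rightarrow> real ^ 'n \<Rightarrow> complex" where
  "iter_partial is f = foldr partial_deriv is f"

definition smooth :: "(real ^ 'n \<Rightarrow> complex) \<Rightarrow> bool" where
  "smooth f \<longleftrightarrow> (\<forall>is x. iter_partial is f differentiable (at x))"

text \<open>Functions on the torus are identified with lattice-periodic functions on Euclidean space.\<close>

definition test_functions :: "(real ^ 'n \<Rightarrow> complex) set" where
  "test_functions = {f. smooth f \<and> (\<forall>x. \<forall>k\<in>int_lattice. f (x + k) = f x)}"

definition seminorm :: "'n list \<Rightarrow> (real ^ 'n \<Rightarrow> complex) \<Rightarrow> real" where
  "seminorm is f = (SUP x. norm (iter_partial is f x))"

text \<open>The usual Frechet topology: uniform convergence of all derivatives.\<close>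

definition test_topology :: "(real ^ 'n \<Rightarrow> complex) topology" where
  "test_topology = topology_generated_by
     {{g \<in> test_functions. seminorm is (\<lambda>x. g x - f x) < r} | is f r. f \<in> test_functions \<and> r > 0}"

text \<open>Continuous linear functionals on the test functions. They are represented by total
  functions that vanish outside the test functions, so that equality of distributions is equality
  in HOL and the vector space operations are the pointwise ones.\<close>

definition distributions :: "((real ^ 'n \<Rightarrow> complex) \<Rightarrow> complex) set" where
  "distributions = {u.
     (\<forall>f\<in>test_functions. \<forall>g\<in>test_functions. u (\<lambda>x. f x + g x) = u f + u g) \<and>
     (\<forall>c. \<forall>f\<in>test_functions. u (\<lambda>x. c * f x) = c * u f) \<and>
     continuous_map test_topology euclidean u \<and>
     (\<forall>f. f \<notin> test_functions \<longrightarrow> u f = 0)}"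

interpretation functional: vector_space "\<lambda>(c::complex) (u :: 'a \<Rightarrow> complex) x. c * u x"
  by unfold_locales (auto simp: fun_eq_iff algebra_simps)

text \<open>Linearly independent tuples have distinct entries, so unordered ones are sets.\<close>

definition planes :: "nat \<Rightarrow> (real ^ 'n) set set" where
  "planes d = {A. A \<subseteq> int_lattice - {0} \<and> independent A \<and> card A = d}"

text \<open>The cube of integration is indexed by the vectors of \<open>A\<close> themselves; by Fubini the
  ordering of the vectors is irrelevant.\<close>

definition radon_fun :: "(real ^ 'n \<Rightarrow> complex) \<Rightarrow> real ^ 'n \<Rightarrow> (real ^ 'n) set \<Rightarrow> complex" where
  "radon_fun f x A =
     (LINT t : (A \<rightarrow>\<^sub>E {0..1}) | (\<Pi>\<^sub>M v\<in>A. lborel). f (x + (\<Sum>v\<in>A. t v *\<^sub>R v)))"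

definition radon :: "nat \<Rightarrow> ((real ^ 'n \<Rightarrow> complex) \<Rightarrow> complex) \<Rightarrow>
    (real ^ 'n) set \<Rightarrow> (real ^ 'n \<Rightarrow> complex) \<Rightarrow> complex" where
  "radon d f = (\<lambda>A\<in>planes d. \<lambda>\<eta>. if \<eta> \<in> test_functions then f (\<lambda>x. radon_fun \<eta> x A) else 0)"

definition character :: "real ^ 'n \<Rightarrow> real ^ 'n \<Rightarrow> complex" where
  "character k x = exp (2 * complex_of_real pi * \<i> * complex_of_real (k \<bullet> x))"

definition fourier_coeff :: "((real ^ 'n \<Rightarrow> complex) \<Rightarrow> complex) \<Rightarrow> real ^ 'n \<Rightarrow> complex" where
  "fourier_coeff g k = g (character (- k))"

end

theory Submission
  imports Defs
begin

text \<open>For a fixed plane \<open>A\<close> the Radon transform of a test function is an average of its translates. It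
  therefore commutes with all partial derivatives and is continuous on the test functions, so its
  dual maps distributions to distributions (\<open>radon_distribution\<close>). A character is multiplied by
  the product over \<open>v \<in> A\<close> of the integrals of \<open>exp (2 pi i t (k \<bullet> v))\<close> over \<open>0 \<le> t \<le> 1\<close>; since
  \<open>k \<bullet> v\<close> is an integer, each factor is \<open>1\<close> or \<open>0\<close> according to whether \<open>k \<bullet> v\<close> vanishes
  (\<open>plane_average_character\<close>). By duality this is the formula for the Fourier coefficients of
  \<open>radon d g\<close> (\<open>fourier_coeff_radon\<close>), which puts the image of \<open>E\<close> inside the right-hand side.

  Conversely, a family \<open>F\<close> on the right-hand side has for each \<open>A\<close> the same Fourier coefficients as
  \<open>radon d g A\<close> for the corresponding \<open>g \<in> E\<close>. It remains to see that a distribution is determined by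
  its Fourier coefficients (\<open>distribution_eqI\<close>), that is, that trigonometric polynomials are dense
  in the test functions. This is done one variable at a time. Averaging \<open>f\<close> in the \<open>i\<close>-th variable
  against the normalised kernel \<open>cos (pi * t) ^ (2 * N)\<close> is again an average over translates, so it
  commutes with derivatives, and it converges to \<open>f\<close> with all derivatives at the rate \<open>1 / sqrt N\<close>
  (\<open>limitin_smoothing\<close>). The kernel is a trigonometric polynomial, so the smoothed function is a
  finite combination of averages against \<open>exp (2 pi i m t)\<close>, and each of those depends on the \<open>i\<close>-th
  variable through a character (\<open>character_along_mode\<close>). A function that is a character in every
  variable is a multiple of a character, and induction over the variables finishes the
  argument (\<open>distribution_eq_zero\<close>).\<close>

section \<open>Test functions and their seminorms\<close>

lemma iter_partial_Nil [simp]: "iter_partial [] f = f"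
  by (simp add: iter_partial_def)

lemma iter_partial_Cons [simp]: "iter_partial (i # is) f = partial_deriv i (iter_partial is f)"
  by (simp add: iter_partial_def)

lemma iter_partial_append: "iter_partial (is @ js) f = iter_partial is (iter_partial js f)"
  by (simp add: iter_partial_def)

lemma test_functionsD:
  assumes "f \<in> test_functions"
  shows "iter_partial is f differentiable (at x)" and "k \<in> int_lattice \<Longrightarrow> f (x + k) = f x"
  using assms by (auto simp: test_functions_def smooth_def)

lemma test_differentiable: "f \<in> test_functions \<Longrightarrow> f differentiable (at x)"
  using test_functionsD(1)[of f "[]"] by simp

lemma partial_deriv_eqI:
  "(f has_derivative f') (at x) \<Longrightarrow> partial_deriv i f x = f' (axis i 1)"
  by (simp add: partial_deriv_def flip: frechet_derivative_at)

lemma partial_deriv_periodic: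
  assumes "f differentiable (at (x + k))" and "\<And>y. f (y + k) = f y"
  shows "partial_deriv i f (x + k) = partial_deriv i f x"
proof -
  have shift: "((\<lambda>y. y + k) has_derivative (\<lambda>v. v)) (at x)"
    by (auto intro!: derivative_eq_intros)
  have "(f has_derivative frechet_derivative f (at (x + k))) (at (x + k))"
    using assms(1) frechet_derivative_works by blast
  then have "((\<lambda>y. f (y + k)) has_derivative frechet_derivative f (at (x + k))) (at x)"
    by (rule has_derivative_compose[OF shift])
  then show ?thesis
    by (simp add: assms(2) partial_deriv_eqI) (simp add: partial_deriv_def)
qed

lemma iter_partial_test:
  assumes "f \<in> test_functions"
  shows "iter_partial is f \<in> test_functions"
proof -
  have "iter_partial is f (x + k) = iter_partial is f x" if "k \<in> int_lattice" for x k
  proof (induction "is" arbitrary: x)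
    case Nil
    then show ?case using test_functionsD(2)[OF assms that] by simp
  next
    case (Cons i "is")
    then show ?case
      using partial_deriv_periodic[OF test_functionsD(1)[OF assms]] by simp
  qed
  then show ?thesis
    using test_functionsD(1)[OF assms]
    by (auto simp: test_functions_def smooth_def simp flip: iter_partial_append)
qed

lemma partial_deriv_test: "f \<in> test_functions \<Longrightarrow> partial_deriv i f \<in> test_functions"
  using iter_partial_test[of f "[i]"] by simp

lemma test_continuous_on: "f \<in> test_functions \<Longrightarrow> continuous_on S f"
  using test_differentiable differentiable_imp_continuous_within
  by (metis continuous_at_imp_continuous_on)

lemma test_measurable [measurable]: "f \<in> test_functions \<Longrightarrow> f \<in> borel_measurable borel"
  by (simp add: borel_measurable_continuous_onI test_continuous_on)

text \<open>Every point is a lattice translate of a point of the compact unit cube.\<close>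

lemma test_bounded:
  fixes f :: "real ^ 'n \<Rightarrow> complex"
  assumes "f \<in> test_functions"
  obtains B where "B \<ge> 0" "\<And>x. norm (f x) \<le> B"
proof -
  have "compact (f ` cbox 0 1)"
    by (intro compact_continuous_image test_continuous_on assms compact_cbox)
  then obtain B where B: "norm (f y) \<le> B" if "y \<in> cbox 0 1" for y
    by (meson bounded_iff compact_imp_bounded imageI)
  have "norm (f x) \<le> \<bar>B\<bar>" for x
  proof -
    define k :: "real ^ 'n" where "k = (\<chi> i. of_int \<lfloor>x $ i\<rfloor>)"
    have "x - k \<in> cbox 0 1"
      by (auto simp: mem_box_cart k_def) linarith
    moreover have "k \<in> int_lattice" by (simp add: int_lattice_def k_def)
    ultimately show ?thesis
      using B[of "x - k"] test_functionsD(2)[OF assms, of k "x - k"] by simp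
  qed
  then show ?thesis using that[of "\<bar>B\<bar>"] by simp
qed

lemma iter_partial_add:
  assumes "f \<in> test_functions" "g \<in> test_functions"
  shows "iter_partial is (\<lambda>x. f x + g x) = (\<lambda>x. iter_partial is f x + iter_partial is g x)"
proof (induction "is")
  case (Cons i "is")
  show ?case
  proof
    fix x
    have "((\<lambda>x. iter_partial is f x + iter_partial is g x) has_derivative
      (\<lambda>v. frechet_derivative (iter_partial is f) (at x) v
         + frechet_derivative (iter_partial is g) (at x) v)) (at x)"
      by (intro derivative_intros)
         (simp_all add: test_functionsD(1) assms flip: frechet_derivative_works)
    then show "iter_partial (i # is) (\<lambda>x. f x + g x) x
        = iter_partial (i # is) f x + iter_partial (i # is) g x"
      by (simp add: Cons partial_deriv_eqI) (simp add: partial_deriv_def)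
  qed
qed simp

lemma iter_partial_cmult:
  assumes "f \<in> test_functions"
  shows "iter_partial is (\<lambda>x. c * f x) = (\<lambda>x. c * iter_partial is f x)"
proof (induction "is")
  case (Cons i "is")
  show ?case
  proof
    fix x
    have "((\<lambda>x. c * iter_partial is f x) has_derivative
      (\<lambda>v. c * frechet_derivative (iter_partial is f) (at x) v)) (at x)"
      by (intro derivative_intros)
         (simp_all add: test_functionsD(1) assms flip: frechet_derivative_works)
    then show "iter_partial (i # is) (\<lambda>x. c * f x) x = c * iter_partial (i # is) f x"
      by (simp add: Cons partial_deriv_eqI) (simp add: partial_deriv_def)
  qed
qed simp

lemma test_add:
  assumes "f \<in> test_functions" "g \<in> test_functions"
  shows "(\<lambda>x. f x + g x) \<in> test_functions"
  using assms
  by (auto simp: test_functions_def smooth_def iter_partial_add[OF assms]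
      intro!: differentiable_add)

lemma test_cmult:
  assumes "f \<in> test_functions"
  shows "(\<lambda>x. c * f x) \<in> test_functions"
  using assms
  by (auto simp: test_functions_def smooth_def iter_partial_cmult[OF assms]
      intro!: differentiable_mult)

lemma
  assumes f: "f \<in> test_functions" and g: "g \<in> test_functions"
  shows test_diff: "(\<lambda>x. f x - g x) \<in> test_functions"
    and iter_partial_diff:
      "iter_partial is (\<lambda>x. f x - g x) = (\<lambda>x. iter_partial is f x - iter_partial is g x)"
  using test_add[OF f test_cmult[OF g, of "-1"]]
    iter_partial_add[OF f test_cmult[OF g, of "-1"]] iter_partial_cmult[OF g, of _ "-1"]
  by simp_all

lemma test_zero: "(\<lambda>x :: real ^ 'n. 0) \<in> test_functions"
proof -
  have "iter_partial is (\<lambda>x :: real ^ 'n. 0) = (\<lambda>x. 0)" for "is"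
  proof (induction "is")
    case (Cons i "is")
    show ?case by (rule ext) (simp add: Cons partial_deriv_def)
  qed simp
  then show ?thesis by (auto simp: test_functions_def smooth_def)
qed

lemma iter_partial_zero: "iter_partial is (\<lambda>x :: real ^ 'n. 0) = (\<lambda>x. 0)"
  using iter_partial_cmult[OF test_zero, of "is" 0] by simp

lemma norm_le_seminorm:
  assumes "f \<in> test_functions"
  shows "norm (iter_partial is f x) \<le> seminorm is f"
proof -
  obtain B where "\<And>x. norm (iter_partial is f x) \<le> B"
    using test_bounded[OF iter_partial_test[OF assms]] by blast
  then have "bdd_above (range (\<lambda>x. norm (iter_partial is f x)))" by (auto intro!: bdd_aboveI2)
  then show ?thesis unfolding seminorm_def by (rule cSUP_upper[OF UNIV_I])
qed

lemma seminorm_leI: "(\<And>x. norm (iter_partial is f x) \<le> B) \<Longrightarrow> seminorm is f \<le> B"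
  by (simp add: seminorm_def cSUP_least)

lemma seminorm_diff_triangle:
  assumes "f \<in> test_functions" "g \<in> test_functions" "h \<in> test_functions"
  shows "seminorm is (\<lambda>x. f x - h x) \<le> seminorm is (\<lambda>x. f x - g x) + seminorm is (\<lambda>x. g x - h x)"
proof (rule seminorm_leI)
  fix x
  have "norm (iter_partial is f x - iter_partial is h x)
      \<le> norm (iter_partial is f x - iter_partial is g x)
        + norm (iter_partial is g x - iter_partial is h x)"
    by norm
  also have "\<dots> \<le> seminorm is (\<lambda>x. f x - g x) + seminorm is (\<lambda>x. g x - h x)"
    using norm_le_seminorm[OF test_diff[OF assms(1,2)], of "is" x]
      norm_le_seminorm[OF test_diff[OF assms(2,3)], of "is" x]
    by (simp add: iter_partial_diff assms)
  finally show "norm (iter_partial is (\<lambda>x. f x - h x) x) \<le> \<dots>"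
    by (simp add: iter_partial_diff assms)
qed

section \<open>First-order Taylor expansion with uniform constants\<close>

lemma test_has_derivative:
  fixes f :: "real ^ 'n \<Rightarrow> complex"
  assumes "f \<in> test_functions"
  shows "(f has_derivative (\<lambda>v. \<Sum>i\<in>UNIV. v $ i *\<^sub>R partial_deriv i f x)) (at x)"
proof -
  let ?D = "frechet_derivative f (at x)"
  have D: "(f has_derivative ?D) (at x)"
    using test_differentiable[OF assms] frechet_derivative_works by blast
  then interpret bounded_linear ?D by (rule has_derivative_bounded_linear)
  have "?D v = (\<Sum>i\<in>UNIV. v $ i *\<^sub>R partial_deriv i f x)" for v
  proof -
    have "?D v = ?D (\<Sum>i\<in>UNIV. v $ i *\<^sub>R axis i 1)"
      using basis_expansion[of v] by (simp add: scalar_mult_eq_scaleR)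
    then show ?thesis by (simp add: sum scaleR partial_deriv_def)
  qed
  then have "?D = (\<lambda>v. \<Sum>i\<in>UNIV. v $ i *\<^sub>R partial_deriv i f x)" by auto
  then show ?thesis using D by simp
qed

lemma norm_sum_components_le:
  fixes v :: "real ^ 'n" and a :: "'n \<Rightarrow> complex"
  assumes "\<And>i. norm (a i) \<le> B i"
  shows "norm (\<Sum>i\<in>UNIV. v $ i *\<^sub>R a i) \<le> (\<Sum>i\<in>UNIV. B i) * norm v"
proof -
  have "norm (v $ i *\<^sub>R a i) \<le> B i * norm v" for i
    using mult_mono[OF component_le_norm_cart[of v i] assms[of i]] by (simp add: mult.commute)
  then have "norm (\<Sum>i\<in>UNIV. v $ i *\<^sub>R a i) \<le> (\<Sum>i\<in>UNIV. B i * norm v)"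
    by (intro sum_norm_le)
  then show ?thesis by (simp add: sum_distrib_right)
qed

lemma test_Lipschitz:
  fixes f :: "real ^ 'n \<Rightarrow> complex"
  assumes "f \<in> test_functions"
  obtains L where "L \<ge> 0" "\<And>x y. norm (f x - f y) \<le> L * norm (x - y)"
proof -
  have "\<exists>B. B \<ge> 0 \<and> (\<forall>x. norm (partial_deriv i f x) \<le> B)" for i
    using test_bounded[OF partial_deriv_test[OF assms]] by metis
  then obtain B where B: "\<And>i. B i \<ge> 0" "\<And>i x. norm (partial_deriv i f x) \<le> B i"
    by metis
  have "norm (f x - f y) \<le> (\<Sum>i\<in>UNIV. B i) * norm (x - y)" for x y
    by (rule differentiable_bound[OF convex_UNIV test_has_derivative[OF assms]])
       (auto intro!: onorm_le norm_sum_components_le B)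
  then show ?thesis using that[of "\<Sum>i\<in>UNIV. B i"] B by (simp add: sum_nonneg)
qed

text \<open>Second derivatives of a test function are bounded, so the Taylor remainder is quadratic with a
  constant that does not depend on the base point.\<close>

lemma test_Taylor:
  fixes f :: "real ^ 'n \<Rightarrow> complex"
  assumes "f \<in> test_functions"
  obtains C where "C \<ge> 0" "\<And>x v. norm (f (x + v) - f x - (\<Sum>i\<in>UNIV. v $ i *\<^sub>R partial_deriv i f x))
    \<le> C * (norm v)\<^sup>2"
proof -
  have "\<exists>L. L \<ge> 0 \<and> (\<forall>x y. norm (partial_deriv i f x - partial_deriv i f y) \<le> L * norm (x - y))" for i
    using test_Lipschitz[OF partial_deriv_test[OF assms]] by metis
  then obtain L where L: "\<And>i. L i \<ge> 0"
    "\<And>i x y. norm (partial_deriv i f x - partial_deriv i f y) \<le> L i * norm (x - y)"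
    by metis
  define C where "C = (\<Sum>i\<in>UNIV. L i)"
  have "norm (f (x + v) - f x - (\<Sum>i\<in>UNIV. v $ i *\<^sub>R partial_deriv i f x)) \<le> C * (norm v)\<^sup>2" for x v
  proof -
    let ?D = "\<lambda>y v. \<Sum>i\<in>UNIV. v $ i *\<^sub>R partial_deriv i f y"
    have "norm (f (x + v) - f x - ?D x (x + v - x)) \<le> norm (x + v - x) * (C * norm v)"
    proof (rule differentiable_bound_linearization[where S = "cball x (norm v)"])
      show "x + t *\<^sub>R (x + v - x) \<in> cball x (norm v)" if "t \<in> {0..1}" for t
        using that by (simp add: dist_norm mult_left_le_one_le)
      show "(f has_derivative ?D y) (at y within cball x (norm v))" for y
        by (rule has_derivative_at_withinI[OF test_has_derivative[OF assms]])
      show "onorm (?D y - ?D x) \<le> C * norm v" if "y \<in> cball x (norm v)" for y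
      proof (rule onorm_le)
        fix w :: "real ^ 'n"
        have "norm (\<Sum>i\<in>UNIV. w $ i *\<^sub>R (partial_deriv i f y - partial_deriv i f x))
            \<le> (\<Sum>i\<in>UNIV. L i * norm v) * norm w"
        proof (rule norm_sum_components_le)
          fix i
          show "norm (partial_deriv i f y - partial_deriv i f x) \<le> L i * norm v"
            using L(2)[of i y x] mult_left_mono[OF _ L(1)[of i], of "norm (y - x)" "norm v"] that
            by (simp add: dist_norm norm_minus_commute)
        qed
        then show "norm ((?D y - ?D x) w) \<le> C * norm v * norm w"
          by (simp add: C_def sum_distrib_right scaleR_diff_right sum_subtractf)
      qed
    qed simp
    then show ?thesis by (simp add: power2_eq_square algebra_simps)
  qed
  moreover have "C \<ge> 0" using L by (simp add: C_def sum_nonneg)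
  ultimately show ?thesis using that by blast
qed

section \<open>Weighted averages over translates\<close>

definition translate_average ::
  "'a measure \<Rightarrow> ('a \<Rightarrow> complex) \<Rightarrow> ('a \<Rightarrow> real ^ 'n) \<Rightarrow> (real ^ 'n \<Rightarrow> complex) \<Rightarrow> real ^ 'n \<Rightarrow> complex"
  where "translate_average M w \<phi> f x = (LINT \<omega>|M. w \<omega> * f (x + \<phi> \<omega>))"

text \<open>Both the Radon transform over a fixed plane and convolution along a coordinate axis have this
  form, so one differentiation under the integral sign serves for both.\<close>

locale translate_averaging =
  fixes M :: "'a measure" and w :: "'a \<Rightarrow> complex" and \<phi> :: "'a \<Rightarrow> real ^ 'n"
  assumes weight_integrable: "integrable M w"
    and shift_measurable [measurable]: "\<phi> \<in> borel_measurable M"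
begin

abbreviation "avg \<equiv> translate_average M w \<phi>"

lemma weight_measurable [measurable]: "w \<in> borel_measurable M"
  by (rule borel_measurable_integrable[OF weight_integrable])

lemma integrable_weighted:
  fixes h :: "'a \<Rightarrow> complex"
  assumes [measurable]: "h \<in> borel_measurable M" and "\<And>\<omega>. norm (h \<omega>) \<le> B"
  shows "integrable M (\<lambda>\<omega>. w \<omega> * h \<omega>)"
proof (rule Bochner_Integration.integrable_bound)
  show "integrable M (\<lambda>\<omega>. B * norm (w \<omega>))"
    using weight_integrable by simp
  have "0 \<le> B" using norm_ge_zero order_trans assms(2) by blast
  then show "AE \<omega> in M. norm (w \<omega> * h \<omega>) \<le> norm (B * norm (w \<omega>))"
    using assms(2) by (auto simp: norm_mult mult.commute[of B] intro!: mult_left_mono)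
qed measurable

lemma norm_weighted_le:
  fixes h :: "'a \<Rightarrow> complex"
  assumes [measurable]: "h \<in> borel_measurable M" and "\<And>\<omega>. norm (h \<omega>) \<le> B"
  shows "norm (LINT \<omega>|M. w \<omega> * h \<omega>) \<le> B * (LINT \<omega>|M. norm (w \<omega>))"
proof -
  have "norm (LINT \<omega>|M. w \<omega> * h \<omega>) \<le> (LINT \<omega>|M. norm (w \<omega> * h \<omega>))"
    by (rule integral_norm_bound)
  also have "\<dots> \<le> (LINT \<omega>|M. B * norm (w \<omega>))"
    using weight_integrable integrable_weighted[OF assms]
    by (intro integral_mono integrable_norm)
       (auto simp: norm_mult mult.commute[of B] intro!: mult_left_mono assms(2))
  finally show ?thesis by simp
qed

lemma avg_integrable:
  assumes [measurable]: "f \<in> test_functions"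
  shows "integrable M (\<lambda>\<omega>. w \<omega> * f (x + \<phi> \<omega>))"
proof -
  obtain B where "\<And>x. norm (f x) \<le> B" using test_bounded[OF assms] by blast
  then show ?thesis by (intro integrable_weighted) auto
qed

text \<open>Integrating the first-order expansions of \<open>f\<close> at the points \<open>x + \<phi> \<omega>\<close> gives one of the average,
  because the quadratic remainder bound is the same at all these points.\<close>

lemma avg_has_derivative:
  assumes [measurable]: "f \<in> test_functions"
  shows "(avg f has_derivative (\<lambda>v. \<Sum>i\<in>UNIV. v $ i *\<^sub>R avg (partial_deriv i f) x)) (at x)"
proof -
  note [measurable] = partial_deriv_test[OF assms]
  obtain C where C: "C \<ge> 0" "\<And>x v. norm (f (x + v) - f x - (\<Sum>i\<in>UNIV. v $ i *\<^sub>R partial_deriv i f x))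
      \<le> C * (norm v)\<^sup>2"
    using test_Taylor[OF assms] by blast
  define W where "W = (LINT \<omega>|M. norm (w \<omega>))"
  have "W \<ge> 0" by (simp add: W_def)
  let ?D = "\<lambda>v. \<Sum>i\<in>UNIV. v $ i *\<^sub>R avg (partial_deriv i f) x"
  have remainder: "norm (avg f (x + v) - avg f x - ?D v) \<le> C * W * (norm v)\<^sup>2" for v
  proof -
    define R where "R y = f (y + v) - f y - (\<Sum>i\<in>UNIV. v $ i *\<^sub>R partial_deriv i f y)" for y
    have "avg f (x + v) - avg f x - ?D v = (LINT \<omega>|M. w \<omega> * f (x + v + \<phi> \<omega>)
        - w \<omega> * f (x + \<phi> \<omega>) - (\<Sum>i\<in>UNIV. v $ i *\<^sub>R (w \<omega> * partial_deriv i f (x + \<phi> \<omega>))))"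
      unfolding translate_average_def
      by (subst Bochner_Integration.integral_diff Bochner_Integration.integral_sum
          integral_scaleR_right
          | intro Bochner_Integration.integrable_diff Bochner_Integration.integrable_sum
              integrable_scaleR_right avg_integrable assms partial_deriv_test refl)+
    also have "\<dots> = (LINT \<omega>|M. w \<omega> * R (x + \<phi> \<omega>))"
      by (simp add: R_def algebra_simps sum_distrib_left scaleR_conv_of_real)
    also have "norm \<dots> \<le> C * (norm v)\<^sup>2 * W"
      unfolding W_def
      by (rule norm_weighted_le) (auto simp: R_def intro!: C)
    finally show ?thesis by (simp add: algebra_simps)
  qed
  show ?thesis
    unfolding has_derivative_at_alt
  proof (intro conjI allI impI)
    show "bounded_linear ?D"
      by (intro bounded_linear_sum bounded_linear_compose[OF bounded_linear_scaleR_left] bounded_linear_vec_nth)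
  next
    fix e :: real assume "e > 0"
    define d where "d = e / (C * W + 1)"
    have "C * W \<ge> 0" using \<open>C \<ge> 0\<close> \<open>W \<ge> 0\<close> by simp
    then have "d > 0" using \<open>e > 0\<close> by (simp add: d_def add_nonneg_pos)
    have "norm (avg f y - avg f x - ?D (y - x)) \<le> e * norm (y - x)" if "norm (y - x) < d" for y
    proof -
      have "norm (avg f y - avg f x - ?D (y - x)) \<le> (C * W * norm (y - x)) * norm (y - x)"
        using remainder[of "y - x"] by (simp add: power2_eq_square algebra_simps)
      also have "\<dots> \<le> ((C * W + 1) * d) * norm (y - x)"
        using that \<open>C * W \<ge> 0\<close> by (intro mult_right_mono mult_mono) auto
      also have "(C * W + 1) * d = e" using \<open>C * W \<ge> 0\<close> by (simp add: d_def)
      finally show ?thesis .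
    qed
    then show "\<exists>d>0. \<forall>y. norm (y - x) < d \<longrightarrow> norm (avg f y - avg f x - ?D (y - x)) \<le> e * norm (y - x)"
      using \<open>d > 0\<close> by blast
  qed
qed

lemma partial_deriv_avg:
  assumes "f \<in> test_functions"
  shows "partial_deriv i (avg f) = avg (partial_deriv i f)"
proof
  fix x
  have "(\<Sum>j\<in>UNIV. axis i 1 $ j *\<^sub>R avg (partial_deriv j f) x)
      = (\<Sum>j\<in>UNIV. if j = i then avg (partial_deriv j f) x else 0)"
    by (intro sum.cong) (auto simp: axis_def)
  then show "partial_deriv i (avg f) x = avg (partial_deriv i f) x"
    using partial_deriv_eqI[OF avg_has_derivative[OF assms]] by simp
qed

lemma iter_partial_avg:
  assumes "f \<in> test_functions"
  shows "iter_partial is (avg f) = avg (iter_partial is f)"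
  by (induction "is") (simp_all add: partial_deriv_avg iter_partial_test assms)

lemma avg_test:
  assumes "f \<in> test_functions"
  shows "avg f \<in> test_functions"
proof -
  have "iter_partial is (avg f) differentiable (at x)" for "is" x
    unfolding iter_partial_avg[OF assms] differentiable_def
    using avg_has_derivative[OF iter_partial_test[OF assms]] by blast
  moreover have "avg f (x + k) = avg f x" if "k \<in> int_lattice" for x k
  proof -
    have "f (x + k + \<phi> \<omega>) = f (x + \<phi> \<omega>)" for \<omega>
      using test_functionsD(2)[OF assms that, of "x + \<phi> \<omega>"] by (simp add: algebra_simps)
    then show ?thesis by (simp add: translate_average_def)
  qed
  ultimately show ?thesis by (simp add: test_functions_def smooth_def)
qed

lemma avg_add:
  assumes "f \<in> test_functions" "g \<in> test_functions"
  shows "avg (\<lambda>x. f x + g x) = (\<lambda>x. avg f x + avg g x)"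
  using avg_integrable assms by (simp add: translate_average_def fun_eq_iff distrib_left)

lemma avg_cmult: "avg (\<lambda>x. c * f x) = (\<lambda>x. c * avg f x)"
  by (simp add: translate_average_def fun_eq_iff mult.left_commute)

lemma avg_diff:
  assumes "f \<in> test_functions" "g \<in> test_functions"
  shows "avg (\<lambda>x. f x - g x) = (\<lambda>x. avg f x - avg g x)"
  using avg_integrable assms by (simp add: translate_average_def fun_eq_iff right_diff_distrib)

lemma seminorm_avg_le:
  assumes "f \<in> test_functions"
  shows "seminorm is (avg f) \<le> seminorm is f * (LINT \<omega>|M. norm (w \<omega>))"
proof (rule seminorm_leI)
  fix x
  note [measurable] = iter_partial_test[OF assms, of "is"]
  show "norm (iter_partial is (avg f) x) \<le> seminorm is f * (LINT \<omega>|M. norm (w \<omega>))"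
    unfolding iter_partial_avg[OF assms] translate_average_def
    by (rule norm_weighted_le) (auto intro!: norm_le_seminorm assms)
qed

end

section \<open>The topology of the test functions\<close>

lemma seminorm_zero [simp]: "seminorm is (\<lambda>x :: real ^ 'n. 0) = 0"
  by (simp add: seminorm_def iter_partial_zero)

lemma openin_test_ball:
  "f \<in> test_functions \<Longrightarrow> r > 0 \<Longrightarrow>
    openin test_topology {g \<in> test_functions. seminorm is (\<lambda>x. g x - f x) < r}"
  unfolding test_topology_def by (intro topology_generated_by_Basis) blast

lemma topspace_test_topology [simp]:
  "topspace test_topology = (test_functions :: (real ^ 'n \<Rightarrow> complex) set)"
proof -
  have "f \<in> topspace test_topology" if "f \<in> test_functions" for f :: "real ^ 'n \<Rightarrow> complex"
    using openin_subset[OF openin_test_ball[OF that, of 1 "[]"]] that by auto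
  then show ?thesis by (auto simp: test_topology_def)
qed

text \<open>A map that is Lipschitz for each seminorm pulls every seminorm ball back to an open set: around
  a point of the preimage, the ball of the remaining radius divided by the Lipschitz constant stays
  inside. Balls only form a subbasis, but that is enough for continuity.\<close>

lemma continuous_map_test_topologyI:
  fixes T :: "(real ^ 'n \<Rightarrow> complex) \<Rightarrow> real ^ 'n \<Rightarrow> complex"
  assumes maps: "\<And>f. f \<in> test_functions \<Longrightarrow> T f \<in> test_functions"
    and "W > 0"
    and Lipschitz: "\<And>is f g. f \<in> test_functions \<Longrightarrow> g \<in> test_functions \<Longrightarrow>
      seminorm is (\<lambda>x. T f x - T g x) \<le> W * seminorm is (\<lambda>x. f x - g x)"
  shows "continuous_map test_topology test_topology T"
proof -
  define B :: "(real ^ 'n \<Rightarrow> complex) set set" where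
    "B = {{g \<in> test_functions. seminorm is (\<lambda>x. g x - f x) < r} | is f r. f \<in> test_functions \<and> r > 0}"
  have gen: "test_topology = topology_generated_by B"
    by (simp add: test_topology_def B_def)
  have "continuous_map test_topology (topology_generated_by B) T"
  proof (rule continuous_on_generated_topo)
    fix U assume "U \<in> B"
    then obtain "is" f r where f: "f \<in> test_functions" and "r > 0"
      and U: "U = {g \<in> test_functions. seminorm is (\<lambda>x. g x - f x) < r}"
      unfolding B_def by blast
    show "openin test_topology (T -` U \<inter> topspace test_topology)"
    proof (subst openin_subopen, intro ballI)
      fix g assume "g \<in> T -` U \<inter> topspace test_topology"
      then have g: "g \<in> test_functions" and less: "seminorm is (\<lambda>x. T g x - f x) < r"
        by (auto simp: U)
      define s where "s = (r - seminorm is (\<lambda>x. T g x - f x)) / W"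
      have "s > 0" using less \<open>W > 0\<close> by (simp add: s_def)
      define V where "V = {h \<in> test_functions. seminorm is (\<lambda>x. h x - g x) < s}"
      have "V \<subseteq> T -` U"
      proof
        fix h assume "h \<in> V"
        then have h: "h \<in> test_functions" and "seminorm is (\<lambda>x. h x - g x) < s"
          by (auto simp: V_def)
        then have "seminorm is (\<lambda>x. T h x - T g x) < W * s"
          using Lipschitz[OF h g, of "is"] \<open>W > 0\<close>
          by (meson le_less_trans mult_strict_left_mono)
        then have "seminorm is (\<lambda>x. T h x - T g x) < r - seminorm is (\<lambda>x. T g x - f x)"
          using \<open>W > 0\<close> by (simp add: s_def)
        then have "seminorm is (\<lambda>x. T h x - f x) < r"
          using seminorm_diff_triangle[OF maps[OF h] maps[OF g] f, of "is"] by simp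
        then show "h \<in> T -` U" using maps[OF h] by (simp add: U)
      qed
      moreover have "openin test_topology V" "g \<in> V"
        using openin_test_ball[OF g \<open>s > 0\<close>] g \<open>s > 0\<close> by (auto simp: V_def)
      ultimately show "\<exists>V. openin test_topology V \<and> g \<in> V
          \<and> V \<subseteq> T -` U \<inter> topspace test_topology"
        using openin_subset by blast
    qed
  next
    have "topspace test_topology = \<Union>B"
      by (simp only: gen topology_generated_by_topspace)
    then show "T ` topspace test_topology \<subseteq> \<Union>B"
      using maps by auto
  qed
  then show ?thesis by (simp only: gen)
qed

lemma (in translate_averaging) continuous_map_avg: "continuous_map test_topology test_topology avg"
proof (rule continuous_map_test_topologyI[OF avg_test])
  \<comment> \<open>The summand \<open>1\<close> keeps the constant positive when the weight vanishes almost everywhere.\<close>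
  define W where "W = (LINT \<omega>|M. norm (w \<omega>)) + 1"
  show "W > 0" unfolding W_def by (simp add: add_nonneg_pos)
  fix "is" and f g :: "real ^ 'n \<Rightarrow> complex"
  assume f: "f \<in> test_functions" and g: "g \<in> test_functions"
  have "0 \<le> seminorm is (\<lambda>x. f x - g x)"
    using norm_le_seminorm[OF test_diff[OF f g]] norm_ge_zero order_trans by blast
  then show "seminorm is (\<lambda>x. avg f x - avg g x) \<le> W * seminorm is (\<lambda>x. f x - g x)"
    using seminorm_avg_le[OF test_diff[OF f g], of "is"]
    by (simp add: avg_diff f g W_def algebra_simps)
qed

lemma limitin_test_topology:
  fixes f :: "real ^ 'n \<Rightarrow> complex"
  assumes f: "f \<in> test_functions" and h: "\<And>N. h N \<in> test_functions"
    and lim: "\<And>is. (\<lambda>N. seminorm is (\<lambda>x. h N x - f x)) \<longlonglongrightarrow> 0"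
  shows "limitin test_topology h f sequentially"
proof -
  have "\<forall>\<^sub>F N in sequentially. h N \<in> U"
    if "openin test_topology U" "f \<in> U" for U
    using openin_topology_generated_by[OF that(1)[unfolded test_topology_def]] that(2)
  proof induction
    case (Int a b)
    then show ?case by (auto intro: eventually_conj)
  next
    case (UN K)
    then obtain k where "k \<in> K" "f \<in> k" by blast
    then show ?case using UN.IH by (fastforce elim: eventually_mono)
  next
    case (Basis U)
    then obtain "is" g r where g: "g \<in> test_functions"
      and U: "U = {g' \<in> test_functions. seminorm is (\<lambda>x. g' x - g x) < r}"
      by blast
    have "r - seminorm is (\<lambda>x. f x - g x) > 0" using Basis U by simp
    then have "\<forall>\<^sub>F N in sequentially. seminorm is (\<lambda>x. h N x - f x) < r - seminorm is (\<lambda>x. f x - g x)"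
      using order_tendstoD(2)[OF lim] by blast
    then show ?case
    proof eventually_elim
      case (elim N)
      then show ?case
        using seminorm_diff_triangle[OF h f g, of "is" N] h by (simp add: U)
    qed
  qed simp
  then show ?thesis using f by (simp add: limitin_def)
qed

section \<open>Characters\<close>

definition circle_char :: "int \<Rightarrow> real \<Rightarrow> complex" where
  "circle_char m t = exp (2 * complex_of_real pi * \<i> * complex_of_real (of_int m * t))"

lemma circle_char_add: "circle_char m (s + t) = circle_char m s * circle_char m t"
  by (simp add: circle_char_def algebra_simps flip: exp_add)

lemma circle_char_neg_mult [simp]: "circle_char (- m) t * circle_char m t = 1"
  by (simp add: circle_char_def flip: exp_add)

lemma circle_char_of_int [simp]: "circle_char m (of_int k) = 1"
proof -
  have "circle_char m (of_int k) = exp (2 * of_int (m * k) * of_real pi * \<i>)"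
    by (simp add: circle_char_def algebra_simps)
  then show ?thesis using exp_integer_2pi[of "of_int (m * k)"] by simp
qed

lemma circle_char_zero [simp]: "circle_char 0 t = 1" "circle_char m 0 = 1"
  by (simp_all add: circle_char_def)

lemma circle_char_has_vector_derivative [derivative_intros]:
  "(circle_char m has_vector_derivative 2 * complex_of_real pi * \<i> * of_int m * circle_char m t) (at t within S)"
proof -
  have "((\<lambda>z. exp (2 * complex_of_real pi * \<i> * (of_int m * z))) has_field_derivative
      2 * complex_of_real pi * \<i> * of_int m * circle_char m t) (at (of_real t))"
    by (auto intro!: derivative_eq_intros simp: circle_char_def)
  then show ?thesis
    using has_vector_derivative_real_field[of _ _ t S]
    by (simp add: circle_char_def[abs_def])
qed

lemma continuous_on_circle_char [continuous_intros]: "continuous_on S (circle_char m)"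
  unfolding circle_char_def by (intro continuous_intros)

lemma circle_char_integral:
  "(LINT t|lborel. indicator {0..1} t *\<^sub>R circle_char m t) = (if m = 0 then 1 else 0)"
proof (cases "m = 0")
  case False
  let ?F = "\<lambda>t. circle_char m t / (2 * complex_of_real pi * \<i> * of_int m)"
  have "(LINT t|lborel. indicator {0..1} t *\<^sub>R circle_char m t) = ?F 1 - ?F 0"
  proof (rule integral_FTC_Icc)
    show "(?F has_vector_derivative circle_char m t) (at t within {0..1})" for t
      using has_vector_derivative_divide[OF circle_char_has_vector_derivative[of m t "{0..1}"],
          of "2 * complex_of_real pi * \<i> * of_int m"] False
      by simp
  qed (auto intro: continuous_intros)
  then show ?thesis using False circle_char_of_int[of m 1] by simp
qed simp

lemma inner_int_lattice:
  "k \<in> int_lattice \<Longrightarrow> v \<in> int_lattice \<Longrightarrow> k \<bullet> v \<in> \<int>"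
  by (auto simp: int_lattice_def inner_vec_def intro!: Ints_sum Ints_mult)

lemma character_add: "character k (x + y) = character k x * character k y"
  by (simp add: character_def inner_add_right algebra_simps flip: exp_add)

lemma character_sum: "character k (\<Sum>v\<in>A. g v) = (\<Prod>v\<in>A. character k (g v))"
  by (induction A rule: infinite_finite_induct) (simp_all add: character_add, simp_all add: character_def)

lemma character_scaleR:
  "k \<bullet> v = of_int m \<Longrightarrow> character k (t *\<^sub>R v) = circle_char m t"
  by (simp add: character_def circle_char_def mult.commute)

lemma character_has_derivative:
  "(character k has_derivative
      (\<lambda>v. 2 * complex_of_real pi * \<i> * complex_of_real (k \<bullet> v) * character k x)) (at x)"
proof -
  have "((\<lambda>x. 2 * complex_of_real pi * \<i> * complex_of_real (k \<bullet> x)) has_derivative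
      (\<lambda>v. 2 * complex_of_real pi * \<i> * complex_of_real (k \<bullet> v))) (at x)"
    by (auto intro!: derivative_eq_intros)
  from has_derivative_compose[OF this DERIV_exp[unfolded has_field_derivative_def]]
  show ?thesis by (simp add: character_def[abs_def] mult.commute)
qed

lemma character_test:
  assumes "k \<in> int_lattice"
  shows "character k \<in> test_functions"
proof -
  have "\<exists>c. iter_partial is (character k) = (\<lambda>x. c * character k x)" for "is"
  proof (induction "is")
    case Nil
    show ?case by (auto intro: exI[of _ 1])
  next
    case (Cons i "is")
    then obtain c where c: "iter_partial is (character k) = (\<lambda>x. c * character k x)" by blast
    have "partial_deriv i (\<lambda>x. c * character k x) x
        = c * (2 * complex_of_real pi * \<i> * complex_of_real (k \<bullet> axis i 1) * character k x)" for x
      by (rule partial_deriv_eqI) (intro derivative_intros character_has_derivative)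
    then show ?case
      by (auto simp: c fun_eq_iff intro!: exI[of _ "c * (2 * complex_of_real pi * \<i> * complex_of_real (k \<bullet> axis i 1))"])
  qed
  moreover have "(\<lambda>x. c * character k x) differentiable (at x)" for c x
    using character_has_derivative[of k x] unfolding differentiable_def
    by (blast intro: has_derivative_mult_right)
  ultimately have "smooth (character k)" by (metis smooth_def)
  moreover have "character k (x + v) = character k x" if v: "v \<in> int_lattice" for x v
  proof -
    obtain m where "k \<bullet> v = of_int m"
      using inner_int_lattice[OF assms v] by (auto elim: Ints_cases)
    then show ?thesis
      using character_scaleR[of k v m 1] circle_char_of_int[of m 1] by (simp add: character_add)
  qed
  ultimately show ?thesis by (simp add: test_functions_def)
qed

section \<open>The Radon transform as an average over translates\<close>

text \<open>The Radon transform extends to distributions by duality, so its mapping properties follow from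
  those of the average on test functions, and its Fourier coefficients from its values on
  characters.\<close>

abbreviation cube_measure :: "(real ^ 'n) set \<Rightarrow> (real ^ 'n \<Rightarrow> real) measure" where
  "cube_measure A \<equiv> \<Pi>\<^sub>M v\<in>A. lborel"

abbreviation plane_average :: "(real ^ 'n) set \<Rightarrow> (real ^ 'n \<Rightarrow> complex) \<Rightarrow> real ^ 'n \<Rightarrow> complex" where
  "plane_average A \<equiv> translate_average (cube_measure A) (indicator (A \<rightarrow>\<^sub>E {0..1})) (\<lambda>t. \<Sum>v\<in>A. t v *\<^sub>R v)"

lemma radon_fun_eq: "(\<lambda>x. radon_fun f x A) = plane_average A f"
  by (simp add: radon_fun_def translate_average_def set_lebesgue_integral_def fun_eq_iff
      scaleR_conv_of_real of_real_indicator)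

lemma cube_averaging:
  fixes A :: "(real ^ 'n) set"
  assumes "finite A"
  shows "translate_averaging (cube_measure A) (indicator (A \<rightarrow>\<^sub>E {0..1})) (\<lambda>t. \<Sum>v\<in>A. t v *\<^sub>R v)"
proof
  interpret product_sigma_finite "\<lambda>v :: real ^ 'n. lborel :: real measure"
    by unfold_locales
  have "emeasure (cube_measure A) (A \<rightarrow>\<^sub>E {0..1}) = 1"
    by (subst emeasure_PiM) (auto simp: assms)
  moreover have "A \<rightarrow>\<^sub>E {0..1} \<in> sets (cube_measure A)"
    using assms by (intro sets_PiM_I_finite) auto
  ultimately show "integrable (cube_measure A) (indicator (A \<rightarrow>\<^sub>E {0..1}) :: _ \<Rightarrow> complex)"
    using integrable_of_real[OF integrable_real_indicator, of "A \<rightarrow>\<^sub>E {0..1}" "cube_measure A", where 'a = complex]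
    by (simp add: of_real_indicator)
  show "(\<lambda>t. \<Sum>v\<in>A. t v *\<^sub>R v) \<in> borel_measurable (cube_measure A)"
    by measurable
qed

lemma planes_finite:
  "A \<in> planes d \<Longrightarrow> finite A" and planes_subset: "A \<in> planes d \<Longrightarrow> A \<subseteq> int_lattice"
  by (auto simp: planes_def independent_imp_finite)

text \<open>A character separates the variables of the cube, and the factor belonging to \<open>v\<close> is the integral
  of a character of the circle over a full period.\<close>

lemma plane_average_character:
  fixes k :: "real ^ 'n"
  assumes "k \<in> int_lattice" and "A \<in> planes d"
  shows "plane_average A (character k)
    = (\<lambda>x. (\<Prod>v\<in>A. if v \<bullet> k = 0 then 1 else 0) * character k x)"
proof
  fix x
  interpret product_sigma_finite "\<lambda>v :: real ^ 'n. lborel :: real measure"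
    by unfold_locales
  note [simp] = planes_finite[OF assms(2)]
  define m where "m v = \<lfloor>k \<bullet> v\<rfloor>" for v
  have m: "k \<bullet> v = of_int (m v)" if "v \<in> A" for v
    using inner_int_lattice[OF assms(1)] planes_subset[OF assms(2)] that
    by (auto simp: m_def elim!: Ints_cases)
  let ?h = "\<lambda>v t. indicator {0..1} t *\<^sub>R circle_char (m v) t"
  have "plane_average A (character k) x
      = (LINT t|cube_measure A. character k x * (\<Prod>v\<in>A. ?h v (t v)))"
    unfolding translate_average_def
  proof (rule Bochner_Integration.integral_cong[OF refl])
    fix t assume "t \<in> space (cube_measure A)"
    then have "indicator (A \<rightarrow>\<^sub>E {0..1}) t = (\<Prod>v\<in>A. indicator {0..1} (t v) :: complex)"
      by (auto simp: indicator_def space_PiM PiE_iff)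
    moreover have "character k (x + (\<Sum>v\<in>A. t v *\<^sub>R v))
        = character k x * (\<Prod>v\<in>A. circle_char (m v) (t v))"
      by (simp add: character_add character_sum character_scaleR[OF m])
    ultimately show "indicator (A \<rightarrow>\<^sub>E {0..1}) t * character k (x + (\<Sum>v\<in>A. t v *\<^sub>R v))
        = character k x * (\<Prod>v\<in>A. ?h v (t v))"
      by (simp add: scaleR_conv_of_real of_real_indicator prod.distrib)
  qed
  also have "\<dots> = character k x * (\<Prod>v\<in>A. LINT t|lborel. ?h v t)"
    by (subst integral_mult_right_zero, subst product_integral_prod)
       (auto intro!: borel_integrable_compact continuous_intros)
  also have "(\<Prod>v\<in>A. LINT t|lborel. ?h v t) = (\<Prod>v\<in>A. if v \<bullet> k = 0 then 1 else 0)"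
    by (intro prod.cong refl) (use m in \<open>auto simp: circle_char_integral inner_commute\<close>)
  finally show "plane_average A (character k) x
      = (\<Prod>v\<in>A. if v \<bullet> k = 0 then 1 else 0) * character k x"
    by simp
qed

lemma radon_distribution:
  assumes g: "g \<in> distributions" and A: "A \<in> planes d"
  shows "radon d g A \<in> distributions"
proof -
  interpret translate_averaging "cube_measure A" "indicator (A \<rightarrow>\<^sub>E {0..1})" "\<lambda>t. \<Sum>v\<in>A. t v *\<^sub>R v"
    by (rule cube_averaging[OF planes_finite[OF A]])
  have radon: "radon d g A = (\<lambda>\<eta>. if \<eta> \<in> test_functions then g (plane_average A \<eta>) else 0)"
    using A by (simp add: radon_def radon_fun_eq fun_eq_iff)
  have "continuous_map test_topology euclidean (g \<circ> plane_average A)"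
    using g by (intro continuous_map_compose[OF continuous_map_avg]) (simp add: distributions_def)
  then have "continuous_map test_topology euclidean (radon d g A)"
    by (rule continuous_map_eq) (simp add: radon)
  then show ?thesis
    using g avg_test by (simp add: distributions_def radon test_add test_cmult avg_add avg_cmult)
qed

lemma fourier_coeff_radon:
  assumes g: "g \<in> distributions" and A: "A \<in> planes d" and k: "k \<in> int_lattice"
  shows "fourier_coeff (radon d g A) k
    = fourier_coeff g k * (\<Prod>v\<in>A. if v \<bullet> k = 0 then 1 else 0)"
proof -
  have k': "- k \<in> int_lattice" using k by (simp add: int_lattice_def)
  have "fourier_coeff (radon d g A) k = g (plane_average A (character (- k)))"
    using A character_test[OF k'] by (simp add: fourier_coeff_def radon_def radon_fun_eq)
  also have "\<dots> = (\<Prod>v\<in>A. if v \<bullet> k = 0 then 1 else 0) * g (character (- k))"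
    using g character_test[OF k']
    by (simp add: plane_average_character[OF k' A] distributions_def)
  finally show ?thesis by (simp add: fourier_coeff_def)
qed

section \<open>Averages along a coordinate direction\<close>

abbreviation window :: "(real \<Rightarrow> 'a::real_vector) \<Rightarrow> real \<Rightarrow> 'a" where
  "window h t \<equiv> indicator {- (1/2)..1/2} t *\<^sub>R h t"

abbreviation line_average ::
  "(real \<Rightarrow> complex) \<Rightarrow> 'n \<Rightarrow> (real ^ 'n \<Rightarrow> complex) \<Rightarrow> real ^ 'n \<Rightarrow> complex" where
  "line_average h i \<equiv> translate_average lborel (window h) (\<lambda>t. t *\<^sub>R axis i 1)"

lemma window_integrable:
  fixes h :: "real \<Rightarrow> 'a::{banach, second_countable_topology}"
  shows "continuous_on UNIV h \<Longrightarrow> integrable lborel (window h)"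
  by (intro borel_integrable_compact) (auto intro: continuous_on_subset)

lemma line_averaging:
  assumes "continuous_on UNIV h"
  shows "translate_averaging lborel (window h) (\<lambda>t. t *\<^sub>R axis i 1)"
  by unfold_locales (auto intro: window_integrable assms)

lemma test_has_vector_derivative:
  assumes "f \<in> test_functions"
  shows "((\<lambda>t. f (x + t *\<^sub>R axis i 1)) has_vector_derivative
    partial_deriv i f (x + t *\<^sub>R axis i 1)) (at t within S)"
proof -
  have "((\<lambda>t. x + t *\<^sub>R axis i 1) has_derivative (\<lambda>s. s *\<^sub>R axis i 1)) (at t within S)"
    by (auto intro!: derivative_eq_intros)
  from has_derivative_compose[OF this test_has_derivative[OF assms]]
  have "((\<lambda>t. f (x + t *\<^sub>R axis i 1)) has_derivative (\<lambda>s. \<Sum>j\<in>UNIV. (s *\<^sub>R axis i 1) $ j *\<^sub>R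
    partial_deriv j f (x + t *\<^sub>R axis i 1))) (at t within S)" .
  moreover have "(\<Sum>j\<in>UNIV. (s *\<^sub>R axis i 1) $ j *\<^sub>R partial_deriv j f y) = s *\<^sub>R partial_deriv i f y" for s y
  proof -
    have "(\<Sum>j\<in>UNIV. (s *\<^sub>R axis i 1) $ j *\<^sub>R partial_deriv j f y)
        = (\<Sum>j\<in>UNIV. if j = i then s *\<^sub>R partial_deriv j f y else 0)"
      by (intro sum.cong) (auto simp: axis_def)
    then show ?thesis by simp
  qed
  ultimately show ?thesis by (simp add: has_vector_derivative_def)
qed

text \<open>The functions that are a character of the circle in the \<open>i\<close>-th variable, up to a factor depending
  on the other variables.\<close>

definition character_along :: "'n \<Rightarrow> (real ^ 'n \<Rightarrow> complex) \<Rightarrow> bool" where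
  "character_along i f \<longleftrightarrow> (\<exists>m. \<forall>x s. f (x + s *\<^sub>R axis i 1) = circle_char m s * f x)"

text \<open>The average of \<open>f\<close> against a character of the circle is the corresponding Fourier mode of \<open>f\<close> in
  the \<open>i\<close>-th variable. Integration by parts over a full period, where the boundary terms cancel,
  turns its derivative in that variable into a multiple of itself, and an exponential solves the
  resulting differential equation.\<close>

lemma character_along_mode:
  fixes f :: "real ^ 'n \<Rightarrow> complex"
  assumes f: "f \<in> test_functions"
  shows "character_along i (line_average (circle_char m) i f)"
  unfolding character_along_def
proof (intro exI[of _ "- m"] allI)
  fix x s
  interpret translate_averaging lborel "window (circle_char m)" "\<lambda>t. t *\<^sub>R axis i 1 :: real ^ 'n"
    by (rule line_averaging) (rule continuous_intros)
  let ?c = "2 * complex_of_real pi * \<i> * of_int m"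
  have parts: "avg (partial_deriv i f) y = - ?c * avg f y" for y
  proof -
    let ?p = "\<lambda>t. circle_char m t * f (y + t *\<^sub>R axis i 1)"
    let ?q = "\<lambda>t. circle_char m t * partial_deriv i f (y + t *\<^sub>R axis i 1)
      + ?c * circle_char m t * f (y + t *\<^sub>R axis i 1)"
    have "(LINT t|lborel. window ?q t) = ?p (1/2) - ?p (- (1/2))"
    proof (rule integral_FTC_Icc)
      show "(?p has_vector_derivative ?q t) (at t within {- (1/2)..1/2})" for t
        by (intro has_vector_derivative_mult circle_char_has_vector_derivative
            test_has_vector_derivative f)
      show "continuous_on {- (1/2)..1/2} ?q"
        by (intro continuous_intros
            continuous_on_compose2[OF test_continuous_on[OF f, of UNIV]]
            continuous_on_compose2[OF test_continuous_on[OF partial_deriv_test[OF f], of UNIV]])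
           auto
    qed simp
    also have "?p (1/2) = ?p (- (1/2))"
    proof -
      have "axis i 1 \<in> (int_lattice :: (real ^ 'n) set)"
        by (simp add: int_lattice_def axis_def)
      have half: "y + (- (1/2)) *\<^sub>R axis i 1 + axis i 1 = y + (1/2) *\<^sub>R axis i 1"
        by (simp add: vec_eq_iff axis_def)
      have "f (y + (1/2) *\<^sub>R axis i 1) = f (y + (- (1/2)) *\<^sub>R axis i 1)"
        using test_functionsD(2)[OF f \<open>axis i 1 \<in> int_lattice\<close>, of "y + (- (1/2)) *\<^sub>R axis i 1"]
        unfolding half .
      moreover have "circle_char m (1/2) = circle_char m (- (1/2))"
        using circle_char_add[of m "- (1/2)" 1] circle_char_of_int[of m 1] by simp
      ultimately show ?thesis by simp
    qed
    finally have "(LINT t|lborel. window ?q t) = 0" by simp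
    moreover have "(LINT t|lborel. window ?q t) = avg (partial_deriv i f) y + ?c * avg f y"
    proof -
      have "(LINT t|lborel. window ?q t) = (LINT t|lborel.
          window (circle_char m) t * partial_deriv i f (y + t *\<^sub>R axis i 1)
          + ?c * (window (circle_char m) t * f (y + t *\<^sub>R axis i 1)))"
        by (intro Bochner_Integration.integral_cong) (auto simp: algebra_simps)
      also have "\<dots> = avg (partial_deriv i f) y + ?c * avg f y"
        unfolding translate_average_def
        by (subst Bochner_Integration.integral_add[OF avg_integrable[OF partial_deriv_test[OF f]]
              integrable_mult_right[OF avg_integrable[OF f]]])
           (simp only: integral_mult_right_zero)
      finally show ?thesis .
    qed
    ultimately show ?thesis by (simp add: add_eq_0_iff2)
  qed
  let ?g = "\<lambda>s. circle_char m s * avg f (x + s *\<^sub>R axis i 1)"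
  have "(?g has_vector_derivative 0) (at t within UNIV)" for t
  proof -
    have "(?g has_vector_derivative circle_char m t * avg (partial_deriv i f) (x + t *\<^sub>R axis i 1)
        + ?c * circle_char m t * avg f (x + t *\<^sub>R axis i 1)) (at t)"
      using has_vector_derivative_mult[OF circle_char_has_vector_derivative
          test_has_vector_derivative[OF avg_test[OF f]]]
      by (simp add: partial_deriv_avg[OF f])
    then show ?thesis by (simp add: parts algebra_simps)
  qed
  then obtain c where "\<And>s. ?g s = c"
    using has_vector_derivative_zero_constant[of UNIV ?g] by auto
  then have "?g s = ?g 0" by metis
  then have eq: "avg f x = circle_char m s * avg f (x + s *\<^sub>R axis i 1)" by simp
  show "avg f (x + s *\<^sub>R axis i 1) = circle_char (- m) s * avg f x"
    unfolding eq mult.assoc[symmetric] circle_char_neg_mult mult_1 ..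
qed

text \<open>Translations commute, so averaging in one direction keeps the behaviour in every other one.\<close>

lemma character_along_line_average:
  assumes "character_along j f"
  shows "character_along j (line_average h i f)"
proof -
  obtain m where m: "\<And>x s. f (x + s *\<^sub>R axis j 1) = circle_char m s * f x"
    using assms by (auto simp: character_along_def)
  have "f (x + s *\<^sub>R axis j 1 + t *\<^sub>R axis i 1) = circle_char m s * f (x + t *\<^sub>R axis i 1)" for x s t
    using m[of "x + t *\<^sub>R axis i 1" s] by (simp add: algebra_simps)
  then have "(\<lambda>t. window h t * f (x + s *\<^sub>R axis j 1 + t *\<^sub>R axis i 1))
      = (\<lambda>t. circle_char m s * (window h t * f (x + t *\<^sub>R axis i 1)))" for x s
    by (simp add: fun_eq_iff mult.left_commute)
  then have "line_average h i f (x + s *\<^sub>R axis j 1) = circle_char m s * line_average h i f x" for x s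
    unfolding translate_average_def by (simp only: integral_mult_right_zero)
  then show ?thesis unfolding character_along_def by blast
qed

lemma character_along_all_imp_multiple:
  fixes f :: "real ^ 'n \<Rightarrow> complex"
  assumes "\<And>i. character_along i f"
  obtains k where "k \<in> int_lattice" "f = (\<lambda>x. f 0 * character k x)"
proof -
  obtain m where m: "\<And>i x s. f (x + s *\<^sub>R axis i 1) = circle_char (m i) s * f x"
    using assms unfolding character_along_def by metis
  define k :: "real ^ 'n" where "k = (\<chi> i. of_int (m i))"
  have k: "character k (s *\<^sub>R axis i 1) = circle_char (m i) s" for i s
    by (rule character_scaleR) (simp add: k_def inner_axis)
  have partial_sum: "f (\<Sum>i\<in>I. x $ i *\<^sub>R axis i 1) = f 0 * character k (\<Sum>i\<in>I. x $ i *\<^sub>R axis i 1)"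
    if "finite I" for I x
    using that
  proof induction
    case empty
    show ?case by (simp add: character_def)
  next
    case (insert i I)
    then show ?case
      using m[of "\<Sum>i\<in>I. x $ i *\<^sub>R axis i 1" "x $ i" i]
      by (simp add: character_add k add.commute)
  qed
  have "f x = f 0 * character k x" for x
    using partial_sum[of UNIV x] basis_expansion[of x] by (simp add: scalar_mult_eq_scaleR)
  then have "f = (\<lambda>x. f 0 * character k x)" by blast
  moreover have "k \<in> int_lattice" by (simp add: int_lattice_def k_def)
  ultimately show ?thesis using that by blast
qed

section \<open>A trigonometric approximate identity\<close>

text \<open>The even powers of \<open>cos (pi * t)\<close> are trigonometric polynomials of period \<open>1\<close> and concentrate at the
  integers as the power grows. The window \<open>[-1/2, 1/2]\<close> is one period centred at such a point.\<close>

definition cos_mass :: "nat \<Rightarrow> real" where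
  "cos_mass N = (LINT t|lborel. window (\<lambda>t. cos (pi * t) ^ (2 * N)) t)"

definition cos_kernel :: "nat \<Rightarrow> real \<Rightarrow> real" where
  "cos_kernel N t = cos (pi * t) ^ (2 * N) / cos_mass N"

text \<open>Integration by parts: \<open>sin (pi * t) * cos (pi * t) ^ (2 * N + 1)\<close> vanishes at both ends of the window,
  and its derivative is the combination of the two integrands. So the mean of \<open>(sin (pi * t))\<^sup>2\<close> is
  exactly \<open>1 / (2 * N + 2)\<close>, which expresses the concentration without any estimate of the mass.\<close>

lemma cos_second_moment:
  "cos_mass N = (2 * N + 2) * (LINT t|lborel. window (\<lambda>t. (sin (pi * t))\<^sup>2 * cos (pi * t) ^ (2 * N)) t)"
proof -
  let ?F = "\<lambda>t. sin (pi * t) * cos (pi * t) ^ Suc (2 * N) / pi"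
  let ?f = "\<lambda>t. cos (pi * t) ^ (2 * N) - (2 * N + 2) * ((sin (pi * t))\<^sup>2 * cos (pi * t) ^ (2 * N))"
  have "(LINT t|lborel. window ?f t) = ?F (1/2) - ?F (- (1/2))"
  proof (rule integral_FTC_Icc)
    fix t :: real
    have "(?F has_field_derivative cos (pi * t) * cos (pi * t) ^ Suc (2 * N)
        - (2 * N + 1) * (sin (pi * t))\<^sup>2 * cos (pi * t) ^ (2 * N)) (at t within {- (1/2)..1/2})"
    proof -
      have c: "((\<lambda>t. cos (pi * t)) has_field_derivative - sin (pi * t) * pi) (at t within {- (1/2)..1/2})"
        and s: "((\<lambda>t. sin (pi * t)) has_field_derivative cos (pi * t) * pi) (at t within {- (1/2)..1/2})"
        by (auto intro!: derivative_eq_intros)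
      show ?thesis
        using DERIV_cdivide[OF DERIV_mult'[OF s DERIV_power_Suc[OF c, of "2 * N"]], of pi]
        by (rule DERIV_cong) (simp add: field_simps power2_eq_square)
    qed
    also have "cos (pi * t) * cos (pi * t) ^ Suc (2 * N)
        = (1 - (sin (pi * t))\<^sup>2) * cos (pi * t) ^ (2 * N)"
      unfolding cos_squared_eq[symmetric] by (simp add: power2_eq_square)
    finally show "(?F has_vector_derivative ?f t) (at t within {- (1/2)..1/2})"
      by (simp add: has_real_derivative_iff_has_vector_derivative[symmetric] algebra_simps)
  qed (auto intro!: continuous_intros)
  also have "\<dots> = 0" by simp
  also have "(LINT t|lborel. window ?f t) = cos_mass N
      - (2 * N + 2) * (LINT t|lborel. window (\<lambda>t. (sin (pi * t))\<^sup>2 * cos (pi * t) ^ (2 * N)) t)"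
  proof -
    have "window ?f t = window (\<lambda>t. cos (pi * t) ^ (2 * N)) t
        - (2 * N + 2) * window (\<lambda>t. (sin (pi * t))\<^sup>2 * cos (pi * t) ^ (2 * N)) t" for t
      by (simp add: algebra_simps)
    then show ?thesis
      unfolding cos_mass_def
      by (subst integral_mult_right_zero[symmetric], subst Bochner_Integration.integral_diff[symmetric])
         (auto intro!: integrable_mult_right window_integrable continuous_intros simp del: real_scaleR_def)
  qed
  finally show ?thesis by simp
qed

lemma cos_mass_pos: "cos_mass N > 0"
proof (induction N)
  case 0
  show ?case by (simp add: cos_mass_def)
next
  case (Suc N)
  let ?J = "LINT t|lborel. window (\<lambda>t. (sin (pi * t))\<^sup>2 * cos (pi * t) ^ (2 * N)) t"
  have "cos x ^ (2 * Suc N) = cos x ^ (2 * N) - (sin x)\<^sup>2 * cos x ^ (2 * N)" for x :: real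
  proof -
    have "cos x ^ (2 * Suc N) = (cos x)\<^sup>2 * cos x ^ (2 * N)" by (simp add: power2_eq_square)
    then show ?thesis by (simp add: cos_squared_eq left_diff_distrib)
  qed
  then have "window (\<lambda>t. cos (pi * t) ^ (2 * Suc N)) t = window (\<lambda>t. cos (pi * t) ^ (2 * N)) t
      - window (\<lambda>t. (sin (pi * t))\<^sup>2 * cos (pi * t) ^ (2 * N)) t" for t
    by (simp only: scaleR_diff_right)
  then have "cos_mass (Suc N) = cos_mass N - ?J"
    unfolding cos_mass_def
    by (subst Bochner_Integration.integral_diff[symmetric])
       (auto intro!: window_integrable continuous_intros simp del: real_scaleR_def)
  also have "\<dots> = (2 * N + 1) * ?J"
    using cos_second_moment[of N] by (simp add: algebra_simps)
  also have "\<dots> > 0"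
    using cos_second_moment[of N] Suc by (simp add: zero_less_mult_iff)
  finally show ?case .
qed

lemma abs_le_abs_sin_pi:
  assumes "t \<in> {- (1/2)..1/2 :: real}"
  shows "\<bar>t\<bar> \<le> \<bar>sin (pi * t)\<bar>"
proof -
  define x where "x = pi * \<bar>t\<bar>"
  have x: "0 \<le> x" "x \<le> 2"
  proof -
    have "\<bar>t\<bar> \<le> 1/2" using assms by (auto simp: abs_le_iff)
    then have "pi * \<bar>t\<bar> \<le> pi * (1/2)" by (intro mult_left_mono) auto
    then show "x \<le> 2" unfolding x_def using pi_half_less_two by linarith
  qed (simp add: x_def)
  \<comment> \<open>The cubic term costs at most two thirds of \<open>x\<close>, as \<open>x\<^sup>2 \<le> 4\<close>, and \<open>pi > 3\<close> pays for the rest.\<close>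
  have "\<bar>sin x - (\<Sum>m<3. sin_coeff m * x ^ m)\<bar> \<le> inverse (fact 3) * \<bar>x\<bar> ^ 3"
    by (rule Maclaurin_sin_bound)
  then have "\<bar>sin x - x\<bar> \<le> x ^ 3 / 6"
    using x by (simp add: numeral_3_eq_3 sin_coeff_def fact_numeral)
  then have "sin x \<ge> x - x ^ 3 / 6" by linarith
  also have "x - x ^ 3 / 6 \<ge> x / 3"
    using mult_left_mono[OF power_mono[OF x(2,1), of 2] x(1)] by (simp add: power3_eq_cube power2_eq_square)
  finally have "sin x \<ge> x / 3" by simp
  moreover have "x / 3 \<ge> \<bar>t\<bar>" using mult_right_mono[of 3 pi "\<bar>t\<bar>"] pi_gt3 by (simp add: x_def)
  moreover have "\<bar>sin (pi * t)\<bar> = \<bar>sin x\<bar>" by (cases "t \<ge> 0") (simp_all add: x_def)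
  ultimately show ?thesis by linarith
qed

lemma cos_kernel_nonneg: "cos_kernel N t \<ge> 0"
  using cos_mass_pos[of N] by (simp add: cos_kernel_def)

lemma continuous_on_cos_kernel [continuous_intros]: "continuous_on S (cos_kernel N)"
  using cos_mass_pos[of N] unfolding cos_kernel_def by (intro continuous_intros) auto

lemma cos_kernel_integral: "(LINT t|lborel. window (cos_kernel N) t) = 1"
  using cos_mass_pos[of N] by (simp add: cos_kernel_def cos_mass_def)

text \<open>The first moment is the average distance by which the kernel moves a point. It is bounded by the
  second moment through \<open>2 * a \<le> e + a\<^sup>2 / e\<close> with \<open>a = \<bar>sin (pi * t)\<bar>\<close>; the choice of \<open>e\<close> balances
  the two terms.\<close>

lemma cos_kernel_first_moment:
  "(LINT t|lborel. window (\<lambda>t. cos_kernel N t * \<bar>t\<bar>) t) \<le> 1 / sqrt (N + 1)"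
proof -
  define e where "e = 1 / sqrt (N + 1)"
  have e: "e > 0" "e\<^sup>2 = 1 / (N + 1)" by (simp_all add: e_def power_divide)
  let ?s = "\<lambda>t. (sin (pi * t))\<^sup>2 * cos_kernel N t"
  have bound: "cos_kernel N t * \<bar>t\<bar> \<le> e / 2 * cos_kernel N t + 1 / (2 * e) * ?s t"
    if "t \<in> {- (1/2)..1/2}" for t
  proof -
    have "0 \<le> (e - \<bar>sin (pi * t)\<bar>)\<^sup>2 / (2 * e)" using e by simp
    also have "\<dots> = e / 2 + 1 / (2 * e) * (sin (pi * t))\<^sup>2 - \<bar>sin (pi * t)\<bar>"
      using e(1) by (simp add: power2_diff field_simps) (simp add: power2_eq_square)
    finally have "\<bar>t\<bar> \<le> e / 2 + 1 / (2 * e) * (sin (pi * t))\<^sup>2"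
      using abs_le_abs_sin_pi[OF that] by linarith
    from mult_left_mono[OF this cos_kernel_nonneg[of N t]] show ?thesis
      by (simp add: algebra_simps)
  qed
  have second: "(LINT t|lborel. window ?s t) = e\<^sup>2 / 2"
  proof -
    have "window ?s t = window (\<lambda>t. (sin (pi * t))\<^sup>2 * cos (pi * t) ^ (2 * N)) t / cos_mass N" for t
      by (simp add: cos_kernel_def)
    then have "(LINT t|lborel. window ?s t)
        = (LINT t|lborel. window (\<lambda>t. (sin (pi * t))\<^sup>2 * cos (pi * t) ^ (2 * N)) t) / cos_mass N"
      by (simp del: real_scaleR_def)
    also have "\<dots> = 1 / (2 * N + 2)"
      using cos_second_moment[of N] cos_mass_pos[of N] by (simp add: field_simps)
    finally show ?thesis by (simp add: e field_simps)
  qed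
  have "(LINT t|lborel. window (\<lambda>t. cos_kernel N t * \<bar>t\<bar>) t)
      \<le> (LINT t|lborel. e / 2 * window (cos_kernel N) t + 1 / (2 * e) * window ?s t)"
    using bound
    by (intro integral_mono Bochner_Integration.integrable_add integrable_mult_right
        window_integrable continuous_intros) (auto simp: indicator_def)
  also have "\<dots> = e / 2 * (LINT t|lborel. window (cos_kernel N) t) + 1 / (2 * e) * (LINT t|lborel. window ?s t)"
    by (subst Bochner_Integration.integral_add, (intro integrable_mult_right window_integrable continuous_intros)+)
       (simp only: integral_mult_right_zero)
  also have "\<dots> = e / 2 + e / 4"
    unfolding second cos_kernel_integral using e(1) by (simp add: power2_eq_square)
  also have "\<dots> \<le> e" using e(1) by simp
  finally show ?thesis by (simp add: e_def)
qed

lemma cos_kernel_trigonometric: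
  obtains c where "\<And>t. complex_of_real (cos_kernel N t) = (\<Sum>k\<le>2 * N. c k * circle_char (int k - int N) t)"
proof
  fix t
  let ?z = "\<i> * complex_of_real (pi * t)"
  have "complex_of_real (cos (pi * t) ^ (2 * N)) = ((exp ?z + exp (- ?z)) / 2) ^ (2 * N)"
    by (simp add: cos_exp_eq flip: cos_of_real)
  also have "\<dots> = (\<Sum>k\<le>2 * N. of_nat (2 * N choose k) * exp ?z ^ k * exp (- ?z) ^ (2 * N - k)) / 2 ^ (2 * N)"
    by (simp add: binomial_ring power_divide)
  also have "\<dots> = (\<Sum>k\<le>2 * N. of_nat (2 * N choose k) / 2 ^ (2 * N) * circle_char (int k - int N) t)"
    unfolding sum_divide_distrib
  proof (intro sum.cong refl)
    fix k assume "k \<in> {..2 * N}"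
    then have "exp ?z ^ k * exp (- ?z) ^ (2 * N - k) = circle_char (int k - int N) t"
      by (simp add: circle_char_def of_nat_diff algebra_simps flip: exp_of_nat_mult exp_add)
    then show "of_nat (2 * N choose k) * exp ?z ^ k * exp (- ?z) ^ (2 * N - k) / 2 ^ (2 * N)
        = of_nat (2 * N choose k) / 2 ^ (2 * N) * circle_char (int k - int N) t"
      by (simp add: mult.assoc)
  qed
  finally show "complex_of_real (cos_kernel N t) = (\<Sum>k\<le>2 * N.
      (of_nat (2 * N choose k) / 2 ^ (2 * N) / of_real (cos_mass N)) * circle_char (int k - int N) t)"
    by (simp add: cos_kernel_def sum_divide_distrib)
qed

abbreviation smoothing :: "nat \<Rightarrow> 'n \<Rightarrow> (real ^ 'n \<Rightarrow> complex) \<Rightarrow> real ^ 'n \<Rightarrow> complex" where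
  "smoothing N \<equiv> line_average (\<lambda>t. complex_of_real (cos_kernel N t))"

text \<open>A Lipschitz function changes by at most \<open>L * \<bar>t\<bar>\<close> over a shift by \<open>t\<close>, so the error is controlled
  by the first moment of the kernel.\<close>

lemma norm_smoothing_diff_le:
  fixes f :: "real ^ 'n \<Rightarrow> complex"
  assumes f: "f \<in> test_functions" and L: "\<And>x y. norm (f x - f y) \<le> L * norm (x - y)" "L \<ge> 0"
  shows "norm (smoothing N i f x - f x) \<le> L / sqrt (N + 1)"
proof -
  let ?K = "\<lambda>t. complex_of_real (cos_kernel N t)"
  interpret translate_averaging lborel "window ?K" "\<lambda>t. t *\<^sub>R axis i 1 :: real ^ 'n"
    by (rule line_averaging) (intro continuous_intros)
  have "(LINT t|lborel. window ?K t) = 1"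
  proof -
    have "(LINT t|lborel. window ?K t) = (LINT t|lborel. complex_of_real (window (cos_kernel N) t))"
      by (simp add: scaleR_conv_of_real)
    then show ?thesis
      unfolding integral_complex_of_real cos_kernel_integral by simp
  qed
  then have "f x = (LINT t|lborel. window ?K t * f x)"
    by (simp only: integral_mult_left_zero mult_1)
  then have "smoothing N i f x - f x = (LINT t|lborel. window ?K t * f (x + t *\<^sub>R axis i 1))
      - (LINT t|lborel. window ?K t * f x)"
    by (simp only: translate_average_def)
  also have "\<dots> = (LINT t|lborel. window ?K t * f (x + t *\<^sub>R axis i 1) - window ?K t * f x)"
    by (rule Bochner_Integration.integral_diff[symmetric,
          OF avg_integrable[OF f] integrable_mult_left[OF weight_integrable]])
  finally have "norm (smoothing N i f x - f x)
      \<le> (LINT t|lborel. norm (window ?K t * f (x + t *\<^sub>R axis i 1) - window ?K t * f x))"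
    by (simp only: integral_norm_bound)
  also have "\<dots> \<le> (LINT t|lborel. L * window (\<lambda>t. cos_kernel N t * \<bar>t\<bar>) t)"
  proof (rule integral_mono)
    show "integrable lborel (\<lambda>t. norm (window ?K t * f (x + t *\<^sub>R axis i 1) - window ?K t * f x))"
      by (rule integrable_norm[OF Bochner_Integration.integrable_diff[
            OF avg_integrable[OF f] integrable_mult_left[OF weight_integrable]]])
    show "integrable lborel (\<lambda>t. L * window (\<lambda>t. cos_kernel N t * \<bar>t\<bar>) t)"
      by (intro integrable_mult_right window_integrable continuous_intros)
    fix t :: real
    have "norm (window ?K t * f (x + t *\<^sub>R axis i 1) - window ?K t * f x)
        = norm (window ?K t * (f (x + t *\<^sub>R axis i 1) - f x))"
      by (simp only: right_diff_distrib)
    also have "\<dots> = window (cos_kernel N) t * norm (f (x + t *\<^sub>R axis i 1) - f x)"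
      by (cases "t \<in> {- (1/2)..1/2}") (simp_all add: norm_mult cos_kernel_nonneg)
    also have "\<dots> \<le> window (cos_kernel N) t * (L * \<bar>t\<bar>)"
      using L(1)[of "x + t *\<^sub>R axis i 1" x] cos_kernel_nonneg[of N t]
      by (intro mult_left_mono) auto
    finally show "norm (window ?K t * f (x + t *\<^sub>R axis i 1) - window ?K t * f x)
        \<le> L * window (\<lambda>t. cos_kernel N t * \<bar>t\<bar>) t"
      by (simp add: algebra_simps)
  qed
  also have "\<dots> = L * (LINT t|lborel. window (\<lambda>t. cos_kernel N t * \<bar>t\<bar>) t)"
    by (rule integral_mult_right_zero)
  also have "\<dots> \<le> L * (1 / sqrt (N + 1))"
    by (intro mult_left_mono cos_kernel_first_moment L(2))
  finally show ?thesis by simp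
qed

text \<open>Smoothing commutes with all derivatives, and each derivative of \<open>f\<close> is again Lipschitz.\<close>

lemma limitin_smoothing:
  fixes f :: "real ^ 'n \<Rightarrow> complex"
  assumes f: "f \<in> test_functions"
  shows "limitin test_topology (\<lambda>N. smoothing N i f) f sequentially"
proof (rule limitin_test_topology[OF f])
  have avg: "translate_averaging lborel (window (\<lambda>t. complex_of_real (cos_kernel N t)))
      (\<lambda>t. t *\<^sub>R axis i 1 :: real ^ 'n)" for N
    by (rule line_averaging) (intro continuous_intros)
  show S: "smoothing N i f \<in> test_functions" for N
    by (rule translate_averaging.avg_test[OF avg f])
  fix "is"
  let ?g = "iter_partial is f"
  obtain L where L: "L \<ge> 0" "\<And>x y. norm (?g x - ?g y) \<le> L * norm (x - y)"
    using test_Lipschitz[OF iter_partial_test[OF f]] by blast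
  have upper: "seminorm is (\<lambda>x. smoothing N i f x - f x) \<le> L / sqrt (N + 1)" for N
    using norm_smoothing_diff_le[OF iter_partial_test[OF f] L(2,1)]
    by (intro seminorm_leI)
       (simp add: iter_partial_diff[OF S f] translate_averaging.iter_partial_avg[OF avg f])
  have lower: "0 \<le> seminorm is (\<lambda>x. smoothing N i f x - f x)" for N
    using norm_le_seminorm[OF test_diff[OF S f]] norm_ge_zero order_trans by blast
  have "(\<lambda>N. L * sqrt (inverse (real (Suc N)))) \<longlonglongrightarrow> L * sqrt 0"
    by (intro tendsto_intros LIMSEQ_inverse_real_of_nat)
  then have "(\<lambda>N. L / sqrt (N + 1)) \<longlonglongrightarrow> 0"
    by (simp add: real_sqrt_inverse divide_inverse add.commute)
  then show "(\<lambda>N. seminorm is (\<lambda>x. smoothing N i f x - f x)) \<longlonglongrightarrow> 0"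
    by (rule tendsto_sandwich[OF _ _ tendsto_const, rotated 2])
       (use upper lower in \<open>auto simp: add.commute\<close>)
qed

section \<open>Distributions are determined by their Fourier coefficients\<close>

lemma distribution_sum:
  assumes u: "u \<in> distributions" and h: "\<And>k. k \<in> S \<Longrightarrow> h k \<in> test_functions" and "finite S"
  shows "(\<lambda>x. \<Sum>k\<in>S. c k * h k x) \<in> test_functions \<and>
    u (\<lambda>x. \<Sum>k\<in>S. c k * h k x) = (\<Sum>k\<in>S. c k * u (h k))"
  using \<open>finite S\<close> h
proof induction
  case empty
  have "\<forall>f\<in>test_functions. u (\<lambda>x. 0 * f x) = 0 * u f"
    using u unfolding distributions_def by blast
  from bspec[OF this test_zero] show ?case using test_zero by simp
next
  case (insert k S)
  then show ?case using u by (simp add: distributions_def test_add test_cmult)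
qed

text \<open>Let \<open>I\<close> contain the coordinates in which \<open>f\<close> need not be a character; the induction is on \<open>I\<close>. If
  \<open>I\<close> is empty, \<open>f\<close> is a multiple of a character. Otherwise smooth \<open>f\<close> in one coordinate of \<open>I\<close>: the
  result is a finite combination of Fourier modes of \<open>f\<close> in that coordinate, on which \<open>u\<close> vanishes by
  the induction hypothesis, and it converges to \<open>f\<close>, so that \<open>u f = 0\<close> by continuity.\<close>

lemma distribution_eq_zero:
  fixes u :: "(real ^ 'n \<Rightarrow> complex) \<Rightarrow> complex"
  assumes u: "u \<in> distributions" and zero: "\<And>k. k \<in> int_lattice \<Longrightarrow> u (character k) = 0"
    and f: "f \<in> test_functions"
  shows "u f = 0"
proof -
  have "u f = 0" if "finite I" "f \<in> test_functions" "\<And>j. j \<notin> I \<Longrightarrow> character_along j f" for I f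
    using that
  proof (induction I arbitrary: f)
    case empty
    then obtain k where k: "k \<in> int_lattice" "f = (\<lambda>x. f 0 * character k x)"
      using character_along_all_imp_multiple[of f] by auto
    have "u (\<lambda>x. f 0 * character k x) = f 0 * u (character k)"
      using u character_test[OF k(1)] by (simp add: distributions_def)
    then show ?case using arg_cong[OF k(2), of u] zero[OF k(1)] by simp
  next
    case (insert i I)
    have mode_test: "line_average (circle_char m) i f \<in> test_functions" for m
      by (intro translate_averaging.avg_test line_averaging insert.prems continuous_intros)
    have mode: "u (line_average (circle_char m) i f) = 0" for m
    proof (rule insert.IH[OF mode_test])
      show "character_along j (line_average (circle_char m) i f)" if "j \<notin> I" for j
      proof (cases "j = i")
        case True
        then show ?thesis using character_along_mode[OF insert.prems(1)] by simp
      next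
        case False
        then show ?thesis using that by (intro character_along_line_average insert.prems(2)) simp
      qed
    qed
    have smooth: "u (smoothing N i f) = 0" for N
    proof -
      obtain c where c: "\<And>t. complex_of_real (cos_kernel N t)
          = (\<Sum>k\<le>2 * N. c k * circle_char (int k - int N) t)"
        using cos_kernel_trigonometric by blast
      have "smoothing N i f x
          = (\<Sum>k\<le>2 * N. c k * line_average (circle_char (int k - int N)) i f x)" for x
      proof -
        let ?mode = "\<lambda>k t. window (circle_char (int k - int N)) t * f (x + t *\<^sub>R axis i 1)"
        have "window (\<lambda>t. complex_of_real (cos_kernel N t)) t * f (x + t *\<^sub>R axis i 1)
            = (\<Sum>k\<le>2 * N. c k * ?mode k t)" for t
          unfolding c by (simp add: scaleR_sum_right sum_distrib_right mult.assoc)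
        then have "smoothing N i f x = (LINT t|lborel. (\<Sum>k\<le>2 * N. c k * ?mode k t))"
          by (simp only: translate_average_def)
        also have "\<dots> = (\<Sum>k\<le>2 * N. (LINT t|lborel. c k * ?mode k t))"
          by (intro Bochner_Integration.integral_sum integrable_mult_right
              translate_averaging.avg_integrable[OF line_averaging[OF continuous_on_circle_char]]
              insert.prems)
        also have "\<dots> = (\<Sum>k\<le>2 * N. c k * line_average (circle_char (int k - int N)) i f x)"
          by (simp only: integral_mult_right_zero translate_average_def)
        finally show ?thesis .
      qed
      then have "smoothing N i f = (\<lambda>x. \<Sum>k\<le>2 * N. c k * line_average (circle_char (int k - int N)) i f x)"
        by blast
      moreover have "u (\<lambda>x. \<Sum>k\<le>2 * N. c k * line_average (circle_char (int k - int N)) i f x)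
          = (\<Sum>k\<le>2 * N. c k * u (line_average (circle_char (int k - int N)) i f))"
        by (rule conjunct2[OF distribution_sum[OF u mode_test]]) simp
      ultimately show ?thesis by (simp only: mode mult_zero_right sum.neutral_const)
    qed
    have "continuous_map test_topology euclidean u" using u by (simp add: distributions_def)
    from continuous_map_limit[OF this limitin_smoothing[OF insert.prems(1), of i]]
    have "(\<lambda>N. u (smoothing N i f)) \<longlonglongrightarrow> u f"
      unfolding comp_def limitin_canonical_iff .
    then show ?case unfolding smooth by (simp add: LIMSEQ_const_iff)
  qed
  from this[of UNIV] f show ?thesis by simp
qed

lemma distribution_eqI:
  assumes u: "u \<in> distributions" and v: "v \<in> distributions"
    and eq: "\<And>k. k \<in> int_lattice \<Longrightarrow> fourier_coeff u k = fourier_coeff v k"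
  shows "u = v"
proof
  fix f
  have "(\<lambda>f. u f - v f) \<in> distributions"
    using u v by (auto simp: distributions_def algebra_simps intro!: continuous_map_diff)
  moreover have "u (character k) - v (character k) = 0" if "k \<in> int_lattice" for k
    using eq[of "- k"] that by (simp add: fourier_coeff_def int_lattice_def)
  ultimately have "u f - v f = 0" if "f \<in> test_functions"
    using distribution_eq_zero[of "\<lambda>f. u f - v f"] that by blast
  then show "u f = v f" using u v by (cases "f \<in> test_functions") (auto simp: distributions_def)
qed

theorem theorem3:
  fixes E :: "((real ^ 'n \<Rightarrow> complex) \<Rightarrow> complex) set" and d :: nat
  assumes "CARD('n) \<ge> 2" and "1 \<le> d" and "d < CARD('n)"
    and "E \<subseteq> distributions" and "functional.subspace E"
  shows "radon d ` E =
    {F \<in> planes d \<rightarrow>\<^sub>E distributions. \<exists>g\<in>E. \<forall>k\<in>int_lattice. \<forall>A\<in>planes d.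
       fourier_coeff (F A) k = fourier_coeff g k * (\<Prod>v\<in>A. if v \<bullet> k = 0 then 1 else 0)}"
    (is "_ = ?R")
proof (intro equalityI subsetI)
  fix F assume "F \<in> radon d ` E"
  then obtain g where g: "g \<in> E" "F = radon d g" by blast
  then have dist: "g \<in> distributions" using assms(4) by blast
  show "F \<in> ?R"
    unfolding g(2)
  proof (intro CollectI conjI bexI[OF _ g(1)] ballI)
    show "radon d g \<in> planes d \<rightarrow>\<^sub>E distributions"
    proof (rule PiE_I)
      show "radon d g A \<in> distributions" if "A \<in> planes d" for A
        by (rule radon_distribution[OF dist that])
      show "radon d g A = undefined" if "A \<notin> planes d" for A
        using that by (simp add: radon_def)
    qed
    show "fourier_coeff (radon d g A) k = fourier_coeff g k * (\<Prod>v\<in>A. if v \<bullet> k = 0 then 1 else 0)"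
      if "k \<in> int_lattice" "A \<in> planes d" for k A
      by (rule fourier_coeff_radon[OF dist that(2,1)])
  qed
next
  fix F assume "F \<in> ?R"
  from CollectD[OF this]
  obtain g where F: "F \<in> planes d \<rightarrow>\<^sub>E distributions" and "g \<in> E"
    and coeff: "\<And>k A. k \<in> int_lattice \<Longrightarrow> A \<in> planes d \<Longrightarrow>
      fourier_coeff (F A) k = fourier_coeff g k * (\<Prod>v\<in>A. if v \<bullet> k = 0 then 1 else 0)"
    by blast
  from \<open>g \<in> E\<close> have g: "g \<in> distributions" using assms(4) by blast
  have "F A = radon d g A" for A
  proof (cases "A \<in> planes d")
    case True
    show ?thesis
    proof (rule distribution_eqI)
      show "F A \<in> distributions" by (rule PiE_mem[OF F True])
      show "radon d g A \<in> distributions" by (rule radon_distribution[OF g True])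
      show "fourier_coeff (F A) k = fourier_coeff (radon d g A) k" if "k \<in> int_lattice" for k
        unfolding coeff[OF that True] fourier_coeff_radon[OF g True that] ..
    qed
  next
    case False
    then show ?thesis using PiE_arb[OF F False] by (simp add: radon_def)
  qed
  then have "F = radon d g" by (rule ext)
  then show "F \<in> radon d ` E" using \<open>g \<in> E\<close> by (rule image_eqI)
qed

end
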